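(* Consider compositions $\psi_1\circ\psi_2\circ\cdots\circ\psi_N$ ($N\ge 1$), where each $\psi_j$ is either the star map $\mathfrak s$ or one of the internal star maps $\mathfrak i_n$ ($n\ge 1$), each composition being taken on its natural domain. Every such composition equals a unique composition of the form $$\mathfrak s^{\ell_0}\circ(\mathfrak i_{n_1})^{\ell_1}\circ\cdots\circ(\mathfrak i_{n_k})^{\ell_k}$$ on the domain $\mathbb V_{n_k}$, where $0<n_1<\cdots<n_k$ and $\ell_i\neq 0$ for $i=1,\dots,k$. Here $\ell_0=0$ is allowed and $k=0$ is allowed, but not both; $\mathfrak s^0$ is the identity, and when $k=0$ the composition is $\mathfrak s^{\ell_0}$ (with domain $\mathbb V_0=\mathbb V$).
   Context: Let $\mathbf X$ be a set of atoms with $\mathbb R\subseteq\mathbf X$, and $\mathbb V=\bigcup_{k\ge0}V_k(\mathbf X)$ the superstructure over $\mathbf X$ ($V_0(\mathbf X)=\mathbf X$, $V_{k+1}(\mathbf X)=V_k(\mathbf X)\cup\mathcal P(V_k(\mathbf X))$). Fix a star map $*:\mathbb V\to\mathbb V$, also written $\mathfrak s$ (${}^*A=\mathfrak s(A)$), such that ${}^*\mathbf X=\mathbf X$, ${}^*r=r$ for all $r\in\mathbb R$, ${}^*\mathbb N\ne\mathbb N$, and transfer holds: for every bounded-quantifier formula $\varphi(x_1,\dots,x_k)$ of set theory and all $A_i\in\mathbb V$, $\varphi(A_1,\dots,A_k)\iff\varphi({}^*A_1,\dots,{}^*A_k)$. $\mathfrak s^n$ is the $n$-fold iterate ($\mathfrak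 s^0=$ identity). The $n$-th internal universe is $\mathbb V_n=\bigcup_{X\in\mathbb V}\mathfrak s^n(X)$ ($\mathbb V_0=\mathbb V$); one has $\mathbb V\supset\mathbb V_1\supset\mathbb V_2\supset\cdots$. For $X\in\mathbb V$ the restriction $\mathfrak s\upharpoonright X$ is an element of $\mathbb V$, and the $n$-th internal star map is the function $\mathfrak i_n=\bigcup_{X\in\mathbb V}\mathfrak s^n(\mathfrak s\upharpoonright X):\mathbb V_n\to\mathbb V_{n+1}$. $(\mathfrak i_n)^m$ is the $m$-fold iterate. Natural domains: a composition $\mathfrak i_n\circ\Phi$ is defined on those points where $\Phi$ takes values in $\mathbb V_n$; e.g. for $n>m$ the natural domain of $\mathfrak i_n\circ\mathfrak s^m$ is $\mathbb V_{n-m}$ and that of $\mathfrak i_{k+n}\circ(\mathfrak i_k)^m$ is $\mathbb V_{k+n-m}$. *)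

theory Defs
  imports Complex_Main
begin

text \<open>
  The union of all finite levels of the superstructure over an infinite set is too large to be
  constructed as a type in HOL.  It is therefore axiomatised up to isomorphism: the whole type
  \<^typ>\<open>'v\<close> plays the role of the superstructure, \<open>E\<close> is its membership relation and \<open>X\<close> the
  set of atoms; an element outside \<open>X\<close> is a set, identified with its extension.
\<close>

definition elems :: "('v \<Rightarrow> 'v \<Rightarrow> bool) \<Rightarrow> 'v \<Rightarrow> 'v set" where
  "elems E y = {z. E z y}"

primrec level :: "('v \<Rightarrow> 'v \<Rightarrow> bool) \<Rightarrow> 'v set \<Rightarrow> nat \<Rightarrow> 'v set" where
  "level E X 0 = X"
| "level E X (Suc k) = level E X k \<union> {y. y \<notin> X \<and> elems E y \<subseteq> level E X k}"

locale superstructure =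
  fixes E :: "'v \<Rightarrow> 'v \<Rightarrow> bool" and X :: "'v set"
  assumes atoms_no_elems: "x \<in> X \<Longrightarrow> elems E x = {}"
    and extensional: "y \<notin> X \<Longrightarrow> z \<notin> X \<Longrightarrow> elems E y = elems E z \<Longrightarrow> y = z"
    and full_powerset: "A \<subseteq> level E X k \<Longrightarrow> \<exists>y. y \<notin> X \<and> elems E y = A"
    and exhausted: "(\<Union>k. level E X k) = UNIV"

text \<open>Meaningful when \<open>A\<close> is contained in some level.\<close>

definition mkset :: "('v \<Rightarrow> 'v \<Rightarrow> bool) \<Rightarrow> 'v set \<Rightarrow> 'v set \<Rightarrow> 'v" where
  "mkset E X A = (THE y. y \<notin> X \<and> elems E y = A)"

lemma (in superstructure) mkset_level:
  assumes "A \<subseteq> level E X k"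
  shows "mkset E X A \<notin> X" and "elems E (mkset E X A) = A"
proof -
  have "\<exists>!y. y \<notin> X \<and> elems E y = A"
    using full_powerset[OF assms] extensional by metis
  from theI'[OF this] show "mkset E X A \<notin> X" and "elems E (mkset E X A) = A"
    unfolding mkset_def by auto
qed

definition opair :: "('v \<Rightarrow> 'v \<Rightarrow> bool) \<Rightarrow> 'v set \<Rightarrow> 'v \<Rightarrow> 'v \<Rightarrow> 'v" where
  "opair E X a b = mkset E X {mkset E X {a}, mkset E X {a, b}}"

text \<open>
  Variables are named by natural numbers; \<open>BAll i j \<phi>\<close> is
  \<open>\<forall>x\<^sub>i \<in> x\<^sub>j. \<phi>\<close>.  The remaining connectives and the bounded existential quantifier
  are definable from these.
\<close>

datatype bfm = Mem nat nat | Eq nat nat | Neg bfm | Conj bfm bfm | BAll nat nat bfm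

primrec sat :: "('v \<Rightarrow> 'v \<Rightarrow> bool) \<Rightarrow> bfm \<Rightarrow> (nat \<Rightarrow> 'v) \<Rightarrow> bool" where
  "sat E (Mem i j) a \<longleftrightarrow> E (a i) (a j)"
| "sat E (Eq i j) a \<longleftrightarrow> a i = a j"
| "sat E (Neg \<phi>) a \<longleftrightarrow> \<not> sat E \<phi> a"
| "sat E (Conj \<phi> \<psi>) a \<longleftrightarrow> sat E \<phi> a \<and> sat E \<psi> a"
| "sat E (BAll i j \<phi>) a \<longleftrightarrow> (\<forall>z\<in>elems E (a j). sat E \<phi> (a(i := z)))"

text \<open>The injection \<open>\<rho>\<close> realises the inclusion of the reals in the set of atoms.\<close>

locale star_superstructure = superstructure E X
  for E :: "'v \<Rightarrow> 'v \<Rightarrow> bool" and X :: "'v set" +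
  fixes \<rho> :: "real \<Rightarrow> 'v" and s :: "'v \<Rightarrow> 'v"
  assumes reals_inj: "inj \<rho>"
    and reals_atoms: "range \<rho> \<subseteq> X"
    and star_atoms: "s (mkset E X X) = mkset E X X"
    and star_real: "s (\<rho> r) = \<rho> r"
    and star_nat: "s (mkset E X (\<rho> ` \<nat>)) \<noteq> mkset E X (\<rho> ` \<nat>)"
    and transfer: "sat E \<phi> a \<longleftrightarrow> sat E \<phi> (\<lambda>i. s (a i))"

definition internal_univ :: "('v \<Rightarrow> 'v \<Rightarrow> bool) \<Rightarrow> ('v \<Rightarrow> 'v) \<Rightarrow> nat \<Rightarrow> 'v set" where
  "internal_univ E s n = (\<Union>Y. elems E ((s ^^ n) Y))"

definition star_restr :: "('v \<Rightarrow> 'v \<Rightarrow> bool) \<Rightarrow> 'v set \<Rightarrow> ('v \<Rightarrow> 'v) \<Rightarrow> 'v \<Rightarrow> 'v" where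
  "star_restr E X s Y = mkset E X {opair E X x (s x) | x. x \<in> elems E Y}"

text \<open>
  Maps with a natural domain are partial functions (\<open>None\<close> outside the domain), so that
  \<open>\<circ>\<^sub>m\<close> is composition on the natural domain and equality includes equality of domains.
\<close>

definition star_map :: "('v \<Rightarrow> 'v) \<Rightarrow> 'v \<rightharpoonup> 'v" where
  "star_map s = (\<lambda>x. Some (s x))"

definition internal_star_graph ::
  "('v \<Rightarrow> 'v \<Rightarrow> bool) \<Rightarrow> 'v set \<Rightarrow> ('v \<Rightarrow> 'v) \<Rightarrow> nat \<Rightarrow> ('v \<times> 'v) set" where
  "internal_star_graph E X s n =
     (\<Union>Y. {(y, z). opair E X y z \<in> elems E ((s ^^ n) (star_restr E X s Y))})"

definition internal_star ::
  "('v \<Rightarrow> 'v \<Rightarrow> bool) \<Rightarrow> 'v set \<Rightarrow> ('v \<Rightarrow> 'v) \<Rightarrow> nat \<Rightarrow> 'v \<rightharpoonup> 'v" where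
  "internal_star E X s n y =
     (if y \<in> Domain (internal_star_graph E X s n)
      then Some (THE z. (y, z) \<in> internal_star_graph E X s n) else None)"

definition compose_list :: "('v \<rightharpoonup> 'v) list \<Rightarrow> 'v \<rightharpoonup> 'v" where
  "compose_list fs = foldr (\<circ>\<^sub>m) fs Some"

definition map_power :: "('v \<rightharpoonup> 'v) \<Rightarrow> nat \<Rightarrow> 'v \<rightharpoonup> 'v" where
  "map_power f l = ((\<circ>\<^sub>m) f ^^ l) Some"

text \<open>
  A normal form is given by \<open>l0\<close> and the list \<open>[(n\<^sub>1, l\<^sub>1), \<dots>, (n\<^sub>k, l\<^sub>k)]\<close>.
\<close>

definition admissible :: "nat \<Rightarrow> (nat \<times> nat) list \<Rightarrow> bool" where
  "admissible l0 ps \<longleftrightarrow>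
     sorted_wrt (<) (map fst ps) \<and> (\<forall>(n, l)\<in>set ps. 0 < n \<and> l \<noteq> 0) \<and> \<not> (l0 = 0 \<and> ps = [])"

definition normal_form ::
  "('v \<Rightarrow> 'v \<Rightarrow> bool) \<Rightarrow> 'v set \<Rightarrow> ('v \<Rightarrow> 'v) \<Rightarrow> nat \<Rightarrow> (nat \<times> nat) list \<Rightarrow> 'v \<rightharpoonup> 'v" where
  "normal_form E X s l0 ps =
     map_power (star_map s) l0 \<circ>\<^sub>m
     compose_list (map (\<lambda>(n, l). map_power (internal_star E X s n) l) ps)"

end

theory Submission
  imports Defs
begin

text \<open>
  Write $i_0$ for the star map.  Transferring $\mathfrak{s} \circ i_k = i_{k+1} \circ \mathfrak{s}$
  along $\mathfrak{s}^m$ gives $i_{n+1} \circ i_m = i_m \circ i_n$ for $m \le n$, with equal natural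
  domains, so every word can be sorted by insertion.  For uniqueness, give the elements of
  ${}^*{}^{\cdots}{}^*\mathbb{N}$ a rank: $x$ has rank $r$ if $r$ is least with
  $x \in \mathfrak{s}^r(\mathbb{N})$.  All ranks occur, and $i_a$ fixes the ranks $r \le a$ and raises
  the others by one, like the coface maps of the simplex category.  A sorted word is determined by its
  action on ranks: its least letter $a$ is read off from the first rank $a + 1$ that is moved, and it
  can be cancelled because coface maps are injective.
\<close>

section \<open>Bounded formulas expressing ordered pairs\<close>

definition fex :: "nat \<Rightarrow> nat \<Rightarrow> bfm \<Rightarrow> bfm" where
  "fex i j \<phi> = Neg (BAll i j (Neg \<phi>))"

definition fimp :: "bfm \<Rightarrow> bfm \<Rightarrow> bfm" where
  "fimp \<phi> \<psi> = Neg (Conj \<phi> (Neg \<psi>))"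

text \<open>
  In the formulas below the variables 100--103 are reserved for the bound variables of \<open>fpair\<close>
  and \<open>fpair_mem\<close>.
\<close>

definition fpair :: "nat \<Rightarrow> nat \<Rightarrow> nat \<Rightarrow> bfm" where
  "fpair p x z = fex 100 p (fex 101 p
     (Conj (Conj (Mem x 100) (BAll 102 100 (Eq 102 x)))
       (Conj (Conj (Mem x 101) (Conj (Mem z 101) (BAll 102 101 (fimp (Neg (Eq 102 x)) (Eq 102 z)))))
         (BAll 102 p (fimp (Neg (Eq 102 100)) (Eq 102 101))))))"

definition fpair_mem :: "nat \<Rightarrow> nat \<Rightarrow> nat \<Rightarrow> bfm" where
  "fpair_mem x z r = fex 103 r (fpair 103 x z)"

lemma sat_fex [simp]: "sat E (fex i j \<phi>) a \<longleftrightarrow> (\<exists>z\<in>elems E (a j). sat E \<phi> (a(i := z)))"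
  by (simp add: fex_def)

lemma sat_fimp [simp]: "sat E (fimp \<phi> \<psi>) a \<longleftrightarrow> (sat E \<phi> a \<longrightarrow> sat E \<psi> a)"
  by (simp add: fimp_def)

lemma elems_iff [simp]: "z \<in> elems E y \<longleftrightarrow> E z y"
  by (simp add: elems_def)

lemma ball_elems [simp]: "(\<forall>z\<in>elems E y. P z) \<longleftrightarrow> (\<forall>z. E z y \<longrightarrow> P z)"
  by auto

lemma bex_elems [simp]: "(\<exists>z\<in>elems E y. P z) \<longleftrightarrow> (\<exists>z. E z y \<and> P z)"
  by auto

section \<open>Levels and ordered pairs in the superstructure\<close>

context superstructure
begin

lemma level_mono: "i \<le> j \<Longrightarrow> level E X i \<subseteq> level E X j"
  by (rule lift_Suc_mono_le[where f = "level E X"]) auto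

lemma elems_subset_level: "\<exists>k. elems E y \<subseteq> level E X k"
proof -
  have "y \<in> level E X k \<Longrightarrow> ?thesis" for k
    using atoms_no_elems by (induction k) auto
  moreover obtain k where "y \<in> level E X k"
    using exhausted by blast
  ultimately show ?thesis by blast
qed

lemma finite_subset_level: "finite A \<Longrightarrow> \<exists>k. A \<subseteq> level E X k"
proof (induction rule: finite_induct)
  case (insert x A)
  obtain i j where "A \<subseteq> level E X i" "x \<in> level E X j"
    using insert.IH exhausted by blast
  then have "insert x A \<subseteq> level E X (max i j)"
    using level_mono[of i "max i j"] level_mono[of j "max i j"] by auto
  then show ?case ..
qed simp

lemma mkset_finite:
  assumes "finite A"
  shows "mkset E X A \<notin> X" "elems E (mkset E X A) = A"
  using finite_subset_level[OF assms] mkset_level by auto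

lemma mkset_elems:
  assumes "y \<notin> X"
  shows "mkset E X (elems E y) = y"
proof -
  obtain k where "elems E y \<subseteq> level E X k"
    using elems_subset_level by blast
  from mkset_level[OF this] show ?thesis
    using assms extensional by blast
qed

lemma opair_inject [simp]: "opair E X a b = opair E X c d \<longleftrightarrow> a = c \<and> b = d"
proof
  have inj: "mkset E X A = mkset E X B \<longleftrightarrow> A = B" if "finite A" "finite B" for A B
    using mkset_finite(2)[OF that(1)] mkset_finite(2)[OF that(2)] by metis
  assume "opair E X a b = opair E X c d"
  then show "a = c \<and> b = d"
    by (auto simp: opair_def inj doubleton_eq_iff)
qed simp

text \<open>Characterises Kuratowski pairs with quantifiers bounded by \<open>p\<close> and its
  elements, the form that \<open>fpair\<close> encodes. In the converse, \<open>c\<close>,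
  \<open>d\<close> and \<open>p\<close> have elements, so they are not atoms and extensionality
  identifies them.\<close>

lemma eq_opair_iff:
  "p = opair E X x z \<longleftrightarrow>
     (\<exists>c\<in>elems E p. \<exists>d\<in>elems E p. elems E c = {x} \<and> elems E d = {x, z} \<and> elems E p = {c, d})"
  (is "_ \<longleftrightarrow> ?R")
proof
  assume "p = opair E X x z"
  then have "elems E p = {mkset E X {x}, mkset E X {x, z}}"
    by (simp add: opair_def mkset_finite)
  then show ?R
    using mkset_finite(2)[of "{x}"] mkset_finite(2)[of "{x, z}"] by auto
next
  assume ?R
  then obtain c d where cd: "elems E c = {x}" "elems E d = {x, z}" "elems E p = {c, d}"
    by blast
  then have "c \<notin> X" "d \<notin> X" "p \<notin> X"
    using atoms_no_elems by auto
  with cd show "p = opair E X x z"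
    using mkset_elems[of c] mkset_elems[of d] mkset_elems[of p] by (simp add: opair_def)
qed

lemma opair_level:
  assumes "x \<in> level E X k" "z \<in> level E X k"
  shows "opair E X x z \<in> level E X (Suc (Suc k))"
  using assms by (auto simp: opair_def mkset_finite)

lemma sat_fpair:
  assumes "p \<notin> {100, 101, 102}" "x \<notin> {100, 101, 102}" "z \<notin> {100, 101, 102}"
  shows "sat E (fpair p x z) a \<longleftrightarrow> a p = opair E X (a x) (a z)"
proof -
  have elems_eq: "elems E y = {u} \<longleftrightarrow> E u y \<and> (\<forall>e. E e y \<longrightarrow> e = u)"
    "elems E y = {u, v} \<longleftrightarrow> E u y \<and> E v y \<and> (\<forall>e. E e y \<longrightarrow> e \<noteq> u \<longrightarrow> e = v)" for y u v
    by (auto simp: elems_def)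
  have "a p = opair E X (a x) (a z) \<longleftrightarrow> (\<exists>c. E c (a p) \<and>
      E (a x) c \<and> (\<forall>e. E e c \<longrightarrow> e = a x) \<and> (\<exists>d. E d (a p) \<and>
      (E (a x) d \<and> E (a z) d \<and> (\<forall>e. E e d \<longrightarrow> e \<noteq> a x \<longrightarrow> e = a z)) \<and>
      (\<forall>e. E e (a p) \<longrightarrow> e \<noteq> c \<longrightarrow> e = d)))"
    unfolding eq_opair_iff elems_eq bex_elems by blast
  then show ?thesis
    using assms by (simp add: fpair_def)
qed

lemma sat_fpair_mem [simp]:
  assumes "x < 100" "z < 100" "r < 100"
  shows "sat E (fpair_mem x z r) a \<longleftrightarrow> E (opair E X (a x) (a z)) (a r)"
  using assms by (auto simp: fpair_mem_def sat_fpair)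

end

section \<open>The internal star maps and their domains\<close>

context star_superstructure
begin

abbreviation siter :: "nat \<Rightarrow> 'v \<Rightarrow> 'v" where
  "siter n \<equiv> s ^^ n"

abbreviation restr :: "'v \<Rightarrow> 'v" where
  "restr Y \<equiv> star_restr E X s Y"

abbreviation istar :: "nat \<Rightarrow> 'v \<rightharpoonup> 'v" where
  "istar n \<equiv> internal_star E X s n"

lemma transfer_iter: "sat E \<phi> a \<longleftrightarrow> sat E \<phi> (\<lambda>i. siter n (a i))"
proof (induction n)
  case (Suc n)
  then show ?case
    using transfer[of \<phi> "\<lambda>i. siter n (a i)"] by simp
qed simp

lemma star_mem_iff: "E (s x) (s y) \<longleftrightarrow> E x y"
  using transfer[of "Mem 0 1" "(!) [x, y]"] by simp

text \<open>Justifies the use of \<open>mkset\<close> in \<open>star_restr\<close>: \<open>x\<close>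
  lies in \<open>Y\<close> and \<open>s x\<close> in \<open>s Y\<close>, so arguments and values
  share one level and their pairs lie two levels higher.\<close>

lemma elems_restr: "elems E (restr Y) = {opair E X x (s x) | x. E x Y}"
proof -
  obtain i j where "elems E Y \<subseteq> level E X i" "elems E (s Y) \<subseteq> level E X j"
    using elems_subset_level by meson
  then have "elems E Y \<subseteq> level E X (max i j)" "elems E (s Y) \<subseteq> level E X (max i j)"
    using level_mono[of i "max i j"] level_mono[of j "max i j"] by auto
  then have "opair E X x (s x) \<in> level E X (Suc (Suc (max i j)))" if "E x Y" for x
    using that star_mem_iff by (intro opair_level) (meson elems_iff subsetD)+
  then have "{opair E X x (s x) | x. E x Y} \<subseteq> level E X (Suc (Suc (max i j)))"
    by blast
  from mkset_level(2)[OF this] show ?thesis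
    by (simp add: star_restr_def)
qed

lemma mem_restr_iff [simp]: "E p (restr Y) \<longleftrightarrow> (\<exists>x. E x Y \<and> p = opair E X x (s x))"
  using elems_restr[of Y] by (auto simp: set_eq_iff)

lemma siter_Suc: "siter (Suc n) x = siter n (s x)"
  by (simp add: funpow_swap1)

lemma siter_siter: "siter m (siter n x) = siter (m + n) x"
  by (simp add: funpow_add)

text \<open>Transfers along \<open>siter n\<close> that the restriction of the star map to
  \<open>Y\<close> consists of pairs from \<open>Y\<close> and \<open>s Y\<close>. Here and below
  \<open>(!) [...]\<close> assigns the parameters to the variables 0, 1, and so on; larger indices
  are bound, and the quantifiers overwrite their values.\<close>

lemma siter_restr_memD:
  assumes "E p (siter n (restr Y))"
  shows "\<exists>x z. E x (siter n Y) \<and> E z (siter (Suc n) Y) \<and> p = opair E X x z"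
  using assms
    transfer_iter[of "BAll 3 0 (fex 4 1 (fex 5 2 (fpair 3 4 5)))" "(!) [restr Y, Y, s Y]" n]
  by (auto simp: sat_fpair star_mem_iff siter_Suc simp del: funpow.simps)

lemma siter_restr_total:
  assumes "E x (siter n Y)"
  shows "\<exists>z. E (opair E X x z) (siter n (restr Y))"
  using assms transfer_iter[of "BAll 3 1 (fex 4 2 (fpair_mem 3 4 0))" "(!) [restr Y, Y, s Y]" n]
  by (auto simp: star_mem_iff simp del: funpow.simps)

text \<open>Two sets \<open>Y\<close> and \<open>Y'\<close> are compared because an internal star
  map is a union of graphs over all sets. Any two restrictions of the star map agree where both are
  defined, and \<open>siter n\<close> preserves this.\<close>

lemma siter_restr_unique:
  assumes "E (opair E X x z) (siter n (restr Y))" "E (opair E X x z') (siter n (restr Y'))"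
  shows "z = z'"
proof -
  have "E x (siter n Y)" "E z (siter n (s Y))" "E z' (siter n (s Y'))"
    using siter_restr_memD assms siter_Suc by fastforce+
  then show ?thesis
    using assms transfer_iter[of "BAll 5 0 (BAll 6 1 (BAll 7 3
        (fimp (Conj (fpair_mem 5 6 2) (fpair_mem 5 7 4)) (Eq 6 7))))"
        "(!) [Y, s Y, restr Y, s Y', restr Y']" n]
    by (auto simp del: funpow.simps)
qed

lemma internal_star_graph_iff:
  "(x, z) \<in> internal_star_graph E X s n \<longleftrightarrow> (\<exists>Y. E (opair E X x z) (siter n (restr Y)))"
  by (simp add: internal_star_graph_def)

lemma istar_eq_Some_iff:
  "istar n x = Some z \<longleftrightarrow> (\<exists>Y. E (opair E X x z) (siter n (restr Y)))"
proof -
  have "(THE z. (x, z) \<in> internal_star_graph E X s n) = w"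
    if "(x, w) \<in> internal_star_graph E X s n" for w
    using that siter_restr_unique by (intro the_equality) (auto simp: internal_star_graph_iff)
  then show ?thesis
    by (auto simp: internal_star_def Domain_iff simp flip: internal_star_graph_iff)
qed

lemma istar_SomeI: "E (opair E X x z) (siter n (restr Y)) \<Longrightarrow> istar n x = Some z"
  using istar_eq_Some_iff by blast

lemma internal_univ_iff: "x \<in> internal_univ E s n \<longleftrightarrow> (\<exists>Y. E x (siter n Y))"
  by (simp add: internal_univ_def)

lemma dom_istar: "dom (istar n) = internal_univ E s n"
  using siter_restr_memD siter_restr_total
  by (fastforce simp: dom_def istar_eq_Some_iff internal_univ_iff)

lemma istar_range: "istar n x = Some z \<Longrightarrow> z \<in> internal_univ E s (Suc n)"
  using siter_restr_memD by (fastforce simp: istar_eq_Some_iff internal_univ_iff simp del: funpow.simps)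

lemma internal_univ_antimono: "m \<le> n \<Longrightarrow> internal_univ E s n \<subseteq> internal_univ E s m"
  by (auto simp: internal_univ_iff le_iff_add simp flip: siter_siter)

lemma istar_0: "istar 0 = star_map s"
proof
  fix x
  \<comment> \<open>Every point lies in its singleton, so the restrictions of \<open>s\<close> to
    sets together cover the whole universe.\<close>
  have "E x (mkset E X {x})"
    using mkset_finite(2)[of "{x}"] by auto
  then have "istar 0 x = Some (s x)"
    by (auto simp: istar_eq_Some_iff)
  then show "istar 0 x = star_map s x"
    by (simp add: star_map_def)
qed

section \<open>The exchange law for internal star maps\<close>

lemma istar_star_commute:
  assumes "E (opair E X x z) (siter k (restr Y))"
  shows "E (opair E X (s x) (s z)) (siter (Suc k) (restr Y))"
  using assms transfer[of "fpair_mem 0 1 2" "(!) [x, z, siter k (restr Y)]"] by simp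

text \<open>With \<open>n = m + k\<close>, this is the image under \<open>siter m\<close> of the
  case \<open>m = 0\<close>, which says that s o i_k = i_{k+1} o s. It settles the exchange law at
  points where the right-hand side is defined.\<close>

lemma istar_istar:
  assumes "m \<le> n" "istar n x = Some z"
  obtains u w where "istar m z = Some w" "istar m x = Some u" "istar (Suc n) u = Some w"
proof -
  obtain k where n: "n = m + k"
    using assms(1) le_Suc_ex by blast
  obtain Y where Y: "E (opair E X x z) (siter n (restr Y))"
    using assms(2) istar_eq_Some_iff by blast
  let ?A = "siter k Y" and ?B = "siter (Suc k) Y"
  \<comment> \<open>The case of the star map itself, with \<open>w = s z\<close> and
    \<open>u = s x\<close>. The bounds \<open>?B\<close>, \<open>s ?B\<close> and
    \<open>s ?A\<close> make it a bounded formula.\<close>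
  have "\<exists>z\<in>elems E ?B. \<exists>w\<in>elems E (s ?B). \<exists>u\<in>elems E (s ?A).
      E (opair E X x z) (siter k (restr Y)) \<and> E (opair E X z w) (restr ?B) \<and>
      E (opair E X x u) (restr ?A) \<and> E (opair E X u w) (siter (Suc k) (restr Y))"
    if x: "E x ?A" for x
  proof -
    obtain z where z: "E (opair E X x z) (siter k (restr Y))"
      using siter_restr_total[OF x] by blast
    then have "E z ?B"
      using siter_restr_memD by fastforce
    then show ?thesis
      using x z istar_star_commute[OF z] star_mem_iff
      by (intro bexI[of _ z] bexI[of _ "s z"] bexI[of _ "s x"]) (auto simp del: funpow.simps)
  qed
  then have "sat E (BAll 10 0 (fex 11 1 (fex 12 2 (fex 13 3
      (Conj (fpair_mem 10 11 4) (Conj (fpair_mem 11 12 5)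
        (Conj (fpair_mem 10 13 6) (fpair_mem 13 12 7))))))))
    ((!) [?A, ?B, s ?B, s ?A, siter k (restr Y), restr ?B, restr ?A, siter (Suc k) (restr Y)])"
    by (simp del: funpow.simps mem_restr_iff)
  from transfer_iter[THEN iffD1, OF this, of m] have *: "\<exists>z w u.
      E (opair E X x z) (siter m (siter k (restr Y))) \<and> E (opair E X z w) (siter m (restr ?B)) \<and>
      E (opair E X x u) (siter m (restr ?A)) \<and> E (opair E X u w) (siter m (siter (Suc k) (restr Y)))"
    if "E x (siter m ?A)" for x
    using that by (simp del: funpow.simps) blast
  moreover have "E x (siter m ?A)"
    using siter_restr_memD[OF Y] by (auto simp: n siter_siter)
  ultimately obtain z' w u where zwu:
    "E (opair E X x z') (siter n (restr Y))" "E (opair E X z' w) (siter m (restr ?B))"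
    "E (opair E X x u) (siter m (restr ?A))" "E (opair E X u w) (siter (Suc n) (restr Y))"
    by (fastforce simp: n siter_siter simp del: funpow.simps)
  \<comment> \<open>Transfer yields only some value \<open>z'\<close> at \<open>x\<close>; it is the
    given one because the internal star map is single-valued.\<close>
  moreover have "z' = z"
    using siter_restr_unique zwu(1) Y by blast
  ultimately show thesis
    using that istar_SomeI by blast
qed

text \<open>The domain half of the exchange law. For \<open>m = 0\<close>, \<open>s x\<close> can
  lie in \<open>siter (Suc k) W\<close> only if \<open>x\<close> lies in \<open>siter k W\<close>;
  this is then transferred along \<open>siter m\<close>.\<close>

lemma istar_reflects_univ:
  assumes "m \<le> n" "istar m x = Some u" "u \<in> internal_univ E s (Suc n)"
  shows "x \<in> internal_univ E s n"
proof -
  obtain k where n: "n = m + k"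
    using assms(1) le_Suc_ex by blast
  obtain Y W where Y: "E (opair E X x u) (siter m (restr Y))" and W: "E u (siter (Suc n) W)"
    using assms istar_eq_Some_iff internal_univ_iff by blast
  have "E x (siter m Y)" "E u (siter m (s Y))"
    using siter_restr_memD[OF Y] by (auto simp: siter_Suc simp del: funpow.simps)
  moreover have "E u (siter m (siter (Suc k) W))"
    using W by (simp add: n siter_siter del: funpow.simps)
  moreover have sat: "sat E (BAll 10 0 (BAll 11 1 (fimp (Conj (fpair_mem 10 11 2) (Mem 11 3)) (Mem 10 4))))
    ((!) [Y, s Y, restr Y, siter (Suc k) W, siter k W])"
    by (auto simp: star_mem_iff)
  ultimately have "E x (siter m (siter k W))"
    using Y transfer_iter[THEN iffD1, OF sat, of m] by (auto simp del: funpow.simps)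
  then show ?thesis
    by (auto simp: n internal_univ_iff siter_siter)
qed

lemma istar_swap:
  assumes "m \<le> n"
  shows "istar (Suc n) \<circ>\<^sub>m istar m = istar m \<circ>\<^sub>m istar n"
proof
  fix x
  show "(istar (Suc n) \<circ>\<^sub>m istar m) x = (istar m \<circ>\<^sub>m istar n) x"
  proof (cases "istar n x")
    case None
    then have "x \<notin> internal_univ E s n"
      using dom_istar by blast
    then have "istar (Suc n) u = None" if "istar m x = Some u" for u
      using istar_reflects_univ[OF assms that] dom_istar[of "Suc n"] by blast
    with None show ?thesis
      by (auto simp: map_comp_def split: option.splits)
  next
    case (Some z)
    then show ?thesis
      using istar_istar[OF assms Some] by (metis map_comp_simps(2))
  qed
qed

section \<open>Ranks in the iterated star images of the naturals\<close>

abbreviation nats :: "nat \<Rightarrow> 'v" where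
  "nats c \<equiv> siter c (mkset E X (\<rho> ` \<nat>))"

lemma nats_0: "nats 0 \<notin> X" "elems E (nats 0) = \<rho> ` \<nat>"
  using mkset_level[of "\<rho> ` \<nat>" 0] reals_atoms by auto

lemma star_fixes_nat: "E x (nats 0) \<Longrightarrow> s x = x"
  using nats_0(2) star_real by (auto simp: set_eq_iff)

lemma nats_0_subset: "E x (nats 0) \<Longrightarrow> E x (nats 1)"
  using star_fixes_nat star_mem_iff[of x "nats 0"] by simp

lemma nats_Suc_subset: "E x (nats c) \<Longrightarrow> E x (nats (Suc c))"
  using nats_0_subset transfer_iter[of "BAll 5 0 (Mem 5 1)" "(!) [nats 0, nats 1]" c]
  by (auto simp: siter_Suc simp del: funpow.simps(2))

lemma nats_mono: "c \<le> d \<Longrightarrow> E x (nats c) \<Longrightarrow> E x (nats d)"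
  by (induction d rule: dec_induct) (auto intro: nats_Suc_subset simp del: funpow.simps)

lemma nats_1_proper: "\<exists>x. E x (nats 1) \<and> \<not> E x (nats 0)"
proof (rule ccontr)
  assume "\<not> ?thesis"
  then have "elems E (nats 1) = elems E (nats 0)"
    using nats_0_subset by auto
  \<comment> \<open>Extensionality applies to sets only; \<open>nats 1\<close> is one because it has
    elements.\<close>
  moreover have "nats 1 \<notin> X"
    using calculation nats_0(2) atoms_no_elems by fastforce
  ultimately show False
    using extensional nats_0(1) star_nat by simp
qed

lemma nats_Suc_proper: "\<exists>x. E x (nats (Suc c)) \<and> \<not> E x (nats c)"
  using nats_1_proper transfer_iter[of "fex 5 1 (Neg (Mem 5 0))" "(!) [nats 0, nats 1]" c]
  by (auto simp: siter_Suc simp del: funpow.simps(2))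

text \<open>The star map is the identity on the naturals. Transferred along \<open>siter a\<close>,
  this makes \<open>istar a\<close> the identity on \<open>nats a\<close>, which contains
  \<open>nats c\<close>.\<close>

lemma istar_fixes_nats:
  assumes "c \<le> a" "E x (nats c)"
  shows "istar a x = Some x"
proof -
  have "E x (nats a)"
    using nats_mono assms by blast
  moreover have "sat E (BAll 5 0 (fpair_mem 5 5 1)) ((!) [nats 0, restr (nats 0)])"
    using star_fixes_nat by auto
  ultimately have "E (opair E X x x) (siter a (restr (nats 0)))"
    using transfer_iter[of "BAll 5 0 (fpair_mem 5 5 1)" "(!) [nats 0, restr (nats 0)]" a]
    by auto
  then show ?thesis
    by (rule istar_SomeI)
qed

text \<open>With \<open>c = a + j\<close>, this is the image under \<open>siter a\<close> of a fact
  about \<open>s\<close>: it preserves membership and non-membership while shifting each of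
  \<open>nats j\<close> and \<open>nats (Suc j)\<close> by one.\<close>

lemma istar_raises_nats:
  assumes "a \<le> c" "E x (nats (Suc c))" "\<not> E x (nats c)"
  shows "\<exists>z. istar a x = Some z \<and> E z (nats (Suc (Suc c))) \<and> \<not> E z (nats (Suc c))"
proof -
  obtain j where c: "c = a + j"
    using assms(1) le_Suc_ex by blast
  have "sat E (BAll 5 1 (fimp (Neg (Mem 5 0)) (fex 6 2 (Conj (Neg (Mem 6 1)) (fpair_mem 5 6 3)))))
    ((!) [nats j, nats (Suc j), nats (Suc (Suc j)), restr (nats (Suc j))])"
    by (auto simp: star_mem_iff)
  from transfer_iter[THEN iffD1, OF this, of a] assms(2,3)
  have "\<exists>z. E (opair E X x z) (siter a (restr (nats (Suc j)))) \<and>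
      E z (nats (Suc (Suc c))) \<and> \<not> E z (nats (Suc c))"
    by (auto simp: c siter_siter simp del: funpow.simps)
  then show ?thesis
    using istar_SomeI by blast
qed

definition layer :: "nat \<Rightarrow> 'v set" where
  "layer r = {x. E x (nats r) \<and> (\<forall>c<r. \<not> E x (nats c))}"

lemma layer_nonempty: "layer r \<noteq> {}"
proof (cases r)
  case 0
  have "\<rho> 0 \<in> elems E (nats 0)"
    using nats_0(2) by simp
  then show ?thesis
    by (auto simp: layer_def 0)
next
  case (Suc c)
  then show ?thesis
    using nats_Suc_proper[of c] nats_mono[of _ c] by (auto simp: layer_def less_Suc_eq_le simp del: funpow.simps)
qed

lemma layer_unique: "x \<in> layer r \<Longrightarrow> x \<in> layer r' \<Longrightarrow> r = r'"
  unfolding layer_def by (metis (lifting) linorder_neqE_nat mem_Collect_eq)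

end

section \<open>Words of coface maps\<close>

definition coface :: "nat \<Rightarrow> nat \<Rightarrow> nat" where
  "coface a r = (if r \<le> a then r else Suc r)"

text \<open>\<open>coface a\<close> is the increasing map whose image omits exactly
  \<open>Suc a\<close>.\<close>

lemma inj_coface: "inj (coface a)"
  by (auto simp: inj_def coface_def split: if_splits)

lemma le_foldr_coface: "r \<le> foldr coface w r"
  by (induction w) (auto simp: coface_def)

lemma foldr_coface_fixed: "\<forall>a\<in>set w. r \<le> a \<Longrightarrow> foldr coface w r = r"
  by (induction w) (auto simp: coface_def)

text \<open>The tail \<open>w\<close> never lowers a rank, and \<open>coface a\<close>, applied
  last, moves every rank above \<open>a\<close>.\<close>

lemma foldr_coface_Cons_less: "Suc a < foldr coface (a # w) (Suc a)"
  using le_foldr_coface[of "Suc a" w] by (simp add: coface_def)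

lemma foldr_coface_inject:
  assumes "sorted w" "sorted w'" "foldr coface w = foldr coface w'"
  shows "w = w'"
  using assms
proof (induction w arbitrary: w')
  case Nil
  show ?case
  proof (cases w')
    case (Cons b v')
    then show ?thesis
      using fun_cong[OF Nil.prems(3), of "Suc b"] foldr_coface_Cons_less[of b v'] by simp
  qed simp
next
  case (Cons a v)
  show ?case
  proof (cases w')
    case Nil
    then show ?thesis
      using fun_cong[OF Cons.prems(3), of "Suc a"] foldr_coface_Cons_less[of a v] by simp
  next
    case w': (Cons b v')
    \<comment> \<open>If \<open>b < a\<close>, all letters of the sorted word \<open>a # v\<close>
      are at least \<open>Suc b\<close>, so it fixes the rank \<open>Suc b\<close>, which
      \<open>b # v'\<close> moves.\<close>
    have "a \<le> b"
    proof (rule ccontr)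
      assume "\<not> a \<le> b"
      then have "foldr coface (a # v) (Suc b) = Suc b"
        using Cons.prems(1) by (intro foldr_coface_fixed) auto
      then show False
        using foldr_coface_Cons_less[of b v'] unfolding w'[symmetric] Cons.prems(3) by simp
    qed
    moreover have "b \<le> a"
    proof (rule ccontr)
      assume "\<not> b \<le> a"
      then have "foldr coface (b # v') (Suc a) = Suc a"
        using Cons.prems(2) w' by (intro foldr_coface_fixed) auto
      then show False
        using foldr_coface_Cons_less[of a v] unfolding w'[symmetric] Cons.prems(3) by simp
    qed
    ultimately have "a = b" by simp
    have "foldr coface v r = foldr coface v' r" for r
      using fun_cong[OF Cons.prems(3), of r] by (simp add: w' \<open>a = b\<close> inj_eq[OF inj_coface])
    then have "v = v'"
      using Cons.prems(1,2) w' by (intro Cons.IH) auto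
    then show ?thesis
      using \<open>a = b\<close> w' by simp
  qed
qed

section \<open>Sorting words by insertion under the exchange law\<close>

fun insert_letter :: "nat \<Rightarrow> nat list \<Rightarrow> nat list" where
  "insert_letter a [] = [a]"
| "insert_letter a (b # v) = (if a \<le> b then a # b # v else b # insert_letter (a - 1) v)"

text \<open>A letter that passes a smaller one drops by one, as the exchange law dictates. It drops
  only if it exceeds some \<open>c\<close> with b \<le> c, so it stays at or above
  \<open>b\<close>.\<close>

lemma insert_letter_lower_bound:
  assumes "b \<le> a" "\<forall>x\<in>set v. b \<le> x"
  shows "\<forall>x\<in>set (insert_letter a v). b \<le> x"
  using assms
proof (induction v arbitrary: a)
  case (Cons c v)
  show ?case
    using Cons.prems Cons.IH[of "a - 1"] by (cases "a \<le> c") auto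
qed simp

lemma sorted_insert_letter: "sorted v \<Longrightarrow> sorted (insert_letter a v)"
proof (induction v arbitrary: a)
  case (Cons b v)
  show ?case
  proof (cases "a \<le> b")
    case False
    then have "\<forall>x\<in>set (insert_letter (a - 1) v). b \<le> x"
      using Cons.prems by (intro insert_letter_lower_bound) auto
    then show ?thesis
      using False Cons by simp
  qed (use Cons.prems in auto)
qed simp

lemma insert_letter_neq_Nil: "insert_letter a v \<noteq> []"
  by (cases v) auto

section \<open>Sorted words and lists of exponents\<close>

definition word :: "nat \<Rightarrow> (nat \<times> nat) list \<Rightarrow> nat list" where
  "word l0 ps = replicate l0 0 @ concat (map (\<lambda>(n, l). replicate l n) ps)"

text \<open>Unlike \<open>admissible\<close>, this allows the empty form and so passes to tails in
  inductions.\<close>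

definition strict_blocks :: "(nat \<times> nat) list \<Rightarrow> bool" where
  "strict_blocks ps \<longleftrightarrow> sorted_wrt (<) (map fst ps) \<and> (\<forall>(n, l)\<in>set ps. 0 < n \<and> l \<noteq> 0)"

lemma strict_blocks_Cons:
  "strict_blocks ((n, l) # ps) \<longleftrightarrow>
     0 < n \<and> l \<noteq> 0 \<and> (\<forall>p\<in>set ps. n < fst p) \<and> strict_blocks ps"
  by (auto simp: strict_blocks_def)

lemma admissible_iff: "admissible l0 ps \<longleftrightarrow> strict_blocks ps \<and> \<not> (l0 = 0 \<and> ps = [])"
  by (simp add: admissible_def strict_blocks_def)

lemma filter_replicate_append:
  assumes "\<forall>x\<in>set ys. x \<noteq> n"
  shows "filter (\<lambda>x. x = n) (replicate l n @ ys) = replicate l n"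
    and "filter (\<lambda>x. x \<noteq> n) (replicate l n @ ys) = ys"
  using assms by (auto simp: filter_empty_conv)

text \<open>Filtering for \<open>n\<close> recovers the leading block, and filtering
  \<open>n\<close> out recovers the rest.\<close>

lemma replicate_append_inject:
  assumes "replicate l n @ ys = replicate l' n @ zs" "\<forall>x\<in>set ys. x \<noteq> n" "\<forall>x\<in>set zs. x \<noteq> n"
  shows "l = l' \<and> ys = zs"
  using filter_replicate_append[OF assms(2), of l] filter_replicate_append[OF assms(3), of l'] assms(1)
  by (metis length_replicate)

lemma set_word: "strict_blocks ps \<Longrightarrow> set (word 0 ps) = fst ` set ps"
  by (force simp: word_def strict_blocks_def)

lemma word_0_Cons: "word 0 ((n, l) # ps) = replicate l n @ word 0 ps"
  by (simp add: word_def)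

lemma word_0_inject:
  assumes "strict_blocks ps" "strict_blocks qs" "word 0 ps = word 0 qs"
  shows "ps = qs"
  using assms
proof (induction ps arbitrary: qs)
  case Nil
  then show ?case
    using set_word[of qs] by (simp add: word_def)
next
  case (Cons p ps)
  obtain n l where p: "p = (n, l)" by fastforce
  show ?case
  proof (cases qs)
    case Nil
    then show ?thesis
      using Cons.prems set_word[of "p # ps"] by (simp add: word_def)
  next
    case (Cons q qs')
    obtain m k where q: "q = (m, k)" by fastforce
    note blocks = Cons.prems(1,2)[unfolded Cons p q strict_blocks_Cons]
    have eq: "replicate l n @ word 0 ps = replicate k m @ word 0 qs'"
      using Cons.prems(3) by (simp add: Cons p q word_0_Cons)
    then have "hd (replicate l n @ word 0 ps) = hd (replicate k m @ word 0 qs')"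
      by simp
    \<comment> \<open>Exponents are nonzero, so both leading blocks are nonempty and the heads are
      \<open>n\<close> and \<open>m\<close>.\<close>
    then have "n = m"
      using blocks by (simp add: hd_append)
    moreover have "l = k \<and> word 0 ps = word 0 qs'"
      using eq blocks unfolding \<open>n = m\<close>
      by (intro replicate_append_inject[of l m _ k]) (auto simp: set_word)
    ultimately show ?thesis
      using Cons.IH[of qs'] blocks by (simp add: Cons p q)
  qed
qed

lemma word_eq: "word l0 ps = replicate l0 0 @ word 0 ps"
  by (simp add: word_def)

lemma word_inject:
  assumes "strict_blocks ps" "strict_blocks qs" "word l0 ps = word l0' qs"
  shows "l0 = l0' \<and> ps = qs"
proof -
  have "l0 = l0' \<and> word 0 ps = word 0 qs"
    using assms unfolding word_eq[of l0] word_eq[of l0']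
    by (intro replicate_append_inject) (auto simp: set_word strict_blocks_def)
  then show ?thesis
    using word_0_inject assms by blast
qed

lemma sorted_word: "strict_blocks ps \<Longrightarrow> sorted (word l0 ps)"
proof -
  have "strict_blocks ps \<Longrightarrow> sorted (word 0 ps)"
  proof (induction ps)
    case (Cons p ps)
    then show ?case
      by (cases p) (auto simp: word_0_Cons sorted_append strict_blocks_Cons set_word intro: less_imp_le)
  qed (simp add: word_def)
  then show "strict_blocks ps \<Longrightarrow> sorted (word l0 ps)"
    by (auto simp: word_eq[of l0] sorted_append)
qed

text \<open>The exponents are the lengths of the maximal constant runs of \<open>w\<close>.
  Prepending a letter lengthens the first run or starts a new one.\<close>

lemma sorted_imp_word: "sorted w \<Longrightarrow> \<exists>l0 ps. strict_blocks ps \<and> word l0 ps = w"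
proof (induction w)
  case Nil
  have "strict_blocks [] \<and> word 0 [] = []"
    by (simp add: word_def strict_blocks_def)
  then show ?case by blast
next
  case (Cons a w)
  then obtain l0 ps where w: "strict_blocks ps" "word l0 ps = w" by auto
  show ?case
  proof (cases "a = 0")
    case True
    then have "word (Suc l0) ps = a # w"
      using w by (simp add: word_def)
    then show ?thesis using w by blast
  next
    case False
    \<comment> \<open>A sorted word with a positive first letter does not contain the letter
      0.\<close>
    then have l0: "l0 = 0"
      using Cons.prems w by (cases l0) (auto simp: word_def)
    with w Cons.prems have ge: "\<forall>p\<in>set ps. a \<le> fst p"
      using set_word[of ps] by auto
    show ?thesis
    proof (cases "\<exists>l qs. ps = (a, l) # qs")
      case True
      then obtain l qs where ps: "ps = (a, l) # qs" by blast
      then have "strict_blocks ((a, Suc l) # qs) \<and> word 0 ((a, Suc l) # qs) = a # w"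
        using w l0 by (auto simp: strict_blocks_Cons word_0_Cons)
      then show ?thesis by blast
    next
      case no_a: False
      have "\<forall>p\<in>set ps. a < fst p"
      proof (cases ps)
        case (Cons p qs)
        obtain n l where "p = (n, l)" by fastforce
        then show ?thesis
          using no_a ge w(1) Cons by (auto simp: strict_blocks_Cons)
      qed simp
      then have "strict_blocks ((a, 1) # ps) \<and> word 0 ((a, 1) # ps) = a # w"
        using w l0 False by (auto simp: strict_blocks_Cons word_0_Cons)
      then show ?thesis by blast
    qed
  qed
qed

lemma last_word:
  assumes "admissible l0 ps"
  shows "word l0 ps \<noteq> []" "last (word l0 ps) = (if ps = [] then 0 else fst (last ps))"
proof -
  have "word l0 ps \<noteq> [] \<and> last (word l0 ps) = (if ps = [] then 0 else fst (last ps))"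
    using assms by (cases ps rule: rev_cases) (auto simp: word_def admissible_def)
  then show "word l0 ps \<noteq> []" "last (word l0 ps) = (if ps = [] then 0 else fst (last ps))"
    by auto
qed

section \<open>Composition of partial maps\<close>

lemma map_comp_assoc: "(f \<circ>\<^sub>m g) \<circ>\<^sub>m h = f \<circ>\<^sub>m (g \<circ>\<^sub>m h)"
  by (auto simp: map_comp_def split: option.splits)

lemma Some_map_comp: "Some \<circ>\<^sub>m f = f"
  by (auto simp: map_comp_def split: option.splits)

lemma compose_list_Nil [simp]: "compose_list [] = Some"
  by (simp add: compose_list_def)

lemma compose_list_Cons [simp]: "compose_list (f # fs) = f \<circ>\<^sub>m compose_list fs"
  by (simp add: compose_list_def)

lemma compose_list_append [simp]: "compose_list (fs @ gs) = compose_list fs \<circ>\<^sub>m compose_list gs"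
  by (induction fs) (simp_all add: map_comp_assoc Some_map_comp)

lemma map_power_eq: "map_power f l = compose_list (replicate l f)"
  by (induction l) (simp_all add: map_power_def)

section \<open>Existence, uniqueness and domain of the normal form\<close>

context star_superstructure
begin

abbreviation compose_word :: "nat list \<Rightarrow> 'v \<rightharpoonup> 'v" where
  "compose_word w \<equiv> compose_list (map istar w)"

lemma normal_form_eq: "normal_form E X s l0 ps = compose_word (word l0 ps)"
proof -
  have "compose_list (map (\<lambda>(n, l). map_power (istar n) l) ps) = compose_word (word 0 ps)"
    by (induction ps) (auto simp: word_def map_power_eq)
  then show ?thesis
    by (simp add: normal_form_def word_eq[of l0] map_power_eq istar_0)
qed

text \<open>Each move past a letter \<open>b\<close> is one use of \<open>istar_swap\<close> with
  \<open>m = b\<close> and \<open>Suc n = a\<close>, valid as an equality of partial maps.\<close>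

lemma compose_word_insert_letter: "compose_word (insert_letter a v) = compose_word (a # v)"
proof (induction v arbitrary: a)
  case (Cons b v)
  show ?case
  proof (cases "a \<le> b")
    case False
    then obtain n where "a = Suc n" "b \<le> n"
      by (cases a) auto
    then show ?thesis
      using Cons istar_swap[of b n] by (simp flip: map_comp_assoc)
  qed simp
qed simp

lemma compose_word_eq_sorted:
  "w \<noteq> [] \<Longrightarrow> \<exists>v. v \<noteq> [] \<and> sorted v \<and> compose_word w = compose_word v"
proof (induction w rule: list_nonempty_induct)
  case (single a)
  then show ?case by (intro exI[of _ "[a]"]) simp
next
  case (cons a w)
  then obtain v where "sorted v" "compose_word w = compose_word v" by blast
  then show ?case
    using insert_letter_neq_Nil sorted_insert_letter compose_word_insert_letter[of a v]
    by (intro exI[of _ "insert_letter a v"]) simp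
qed

text \<open>In a sorted word the values of a letter \<open>b\<close> lie in the internal universe of
  index \<open>Suc b\<close>, which is contained in the domain of the preceding letter
  \<open>a\<close>, since a \<le> b. Hence only the last letter, which is applied first, restricts
  the domain.\<close>

lemma dom_compose_word:
  assumes "sorted w" "w \<noteq> []"
  shows "dom (compose_word w) = internal_univ E s (last w)"
  using assms(2,1)
proof (induction w rule: list_nonempty_induct)
  case (single a)
  then show ?case
    by (simp add: dom_istar)
next
  case (cons a w)
  obtain b v where w: "w = b # v"
    using cons.hyps by (cases w) auto
  have "y \<in> dom (istar a)" if "compose_word w x = Some y" for x y
  proof -
    have "y \<in> internal_univ E s (Suc b)"
      using that istar_range by (auto simp: w map_comp_def split: option.splits)
    moreover have "a \<le> Suc b"
      using cons.prems w by simp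
    ultimately show ?thesis
      using internal_univ_antimono dom_istar by blast
  qed
  then have "dom (compose_word (a # w)) = dom (compose_word w)"
    by (fastforce simp: map_comp_def split: option.splits)
  then show ?case
    using cons by simp
qed

lemma istar_layer:
  assumes "x \<in> layer r"
  shows "\<exists>z\<in>layer (coface a r). istar a x = Some z"
proof (cases "r \<le> a")
  case True
  then have "istar a x = Some x"
    using assms istar_fixes_nats by (auto simp: layer_def)
  then show ?thesis
    using assms True by (simp add: coface_def)
next
  case False
  then obtain c where r: "r = Suc c" "a \<le> c"
    by (cases r) auto
  then obtain z where "istar a x = Some z" "E z (nats (Suc (Suc c)))" "\<not> E z (nats (Suc c))"
    using assms istar_raises_nats[of a c x] by (auto simp: layer_def simp del: funpow.simps)
  \<comment> \<open>The sets \<open>nats\<close> increase, so being outside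
    \<open>nats (Suc c)\<close> excludes all smaller indices as well.\<close>
  moreover from this have "z \<in> layer (Suc (Suc c))"
    using nats_mono[of _ "Suc c"] by (auto simp: layer_def less_Suc_eq_le simp del: funpow.simps)
  ultimately show ?thesis
    using r by (simp add: coface_def)
qed

lemma compose_word_layer:
  assumes "x \<in> layer r"
  shows "\<exists>z\<in>layer (foldr coface w r). compose_word w x = Some z"
proof (induction w)
  case Nil
  then show ?case using assms by simp
next
  case (Cons a w)
  then obtain z where "z \<in> layer (foldr coface w r)" "compose_word w x = Some z"
    by blast
  then show ?case
    using istar_layer[of z _ a] by simp
qed

lemma compose_word_inject:
  assumes "sorted w" "sorted w'" "compose_word w = compose_word w'"
  shows "w = w'"
proof -
  have "foldr coface w r = foldr coface w' r" for r
  proof -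
    obtain x where "x \<in> layer r"
      using layer_nonempty by blast
    then show ?thesis
      using compose_word_layer[of x r w] compose_word_layer[of x r w'] assms(3) layer_unique
      by (metis option.inject)
  qed
  then show ?thesis
    using assms foldr_coface_inject by blast
qed

lemma compose_word_normal_form:
  assumes "w \<noteq> []"
  shows "(\<exists>!(l0, ps). admissible l0 ps \<and> compose_word w = normal_form E X s l0 ps) \<and>
    (\<forall>l0 ps. admissible l0 ps \<and> compose_word w = normal_form E X s l0 ps \<longrightarrow>
       dom (compose_word w) = internal_univ E s (if ps = [] then 0 else fst (last ps)))"
proof -
  obtain v where v: "v \<noteq> []" "sorted v" "compose_word w = compose_word v"
    using compose_word_eq_sorted[OF assms] by blast
  obtain l0 ps where ps: "strict_blocks ps" "word l0 ps = v"
    using sorted_imp_word[OF v(2)] by blast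
  \<comment> \<open>Every admissible form of the composition flattens to the same sorted word
    \<open>v\<close>; uniqueness and the domain claim both rest on this.\<close>
  have eq: "word l0' ps' = v"
    if "admissible l0' ps'" "compose_word w = normal_form E X s l0' ps'" for l0' ps'
    using that compose_word_inject sorted_word v by (metis admissible_iff normal_form_eq)
  have "admissible l0 ps"
    using ps v(1) by (auto simp: admissible_iff word_def)
  moreover have "compose_word w = normal_form E X s l0 ps"
    using v ps by (simp add: normal_form_eq)
  moreover have "l0' = l0 \<and> ps' = ps"
    if "admissible l0' ps'" "compose_word w = normal_form E X s l0' ps'" for l0' ps'
    using word_inject[of ps' ps l0' l0] eq[OF that] that(1) ps by (simp add: admissible_iff)
  ultimately have "admissible l0' ps' \<and> compose_word w = normal_form E X s l0' ps' \<longleftrightarrow> l0' = l0 \<and> ps' = ps"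
    for l0' ps' by blast
  then have "\<exists>!(l0, ps). admissible l0 ps \<and> compose_word w = normal_form E X s l0 ps"
    by (intro ex1I[of _ "(l0, ps)"]) (simp_all split: prod.splits)
  moreover have "dom (compose_word w) = internal_univ E s (if ps' = [] then 0 else fst (last ps'))"
    if "admissible l0' ps'" "compose_word w = normal_form E X s l0' ps'" for l0' ps'
    using dom_compose_word[OF v(2,1)] v(3) eq[OF that] last_word(2)[OF that(1)] by simp
  ultimately show ?thesis by blast
qed

end

theorem theorem3p25:
  fixes E :: "'v \<Rightarrow> 'v \<Rightarrow> bool" and X :: "'v set" and \<rho> :: "real \<Rightarrow> 'v" and s :: "'v \<Rightarrow> 'v"
    and \<psi>s :: "('v \<rightharpoonup> 'v) list"
  assumes "star_superstructure E X \<rho> s"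
    and "\<psi>s \<noteq> []"
    and "set \<psi>s \<subseteq> insert (star_map s) {internal_star E X s n | n. n \<ge> 1}"
  shows "(\<exists>!(l0, ps). admissible l0 ps \<and> compose_list \<psi>s = normal_form E X s l0 ps) \<and>
    (\<forall>l0 ps. admissible l0 ps \<and> compose_list \<psi>s = normal_form E X s l0 ps \<longrightarrow>
       dom (compose_list \<psi>s) = internal_univ E s (if ps = [] then 0 else fst (last ps)))"
proof -
  interpret star_superstructure E X \<rho> s by fact
  \<comment> \<open>The star map is \<open>istar 0\<close>, so every factor is a letter.\<close>
  have "set \<psi>s \<subseteq> range istar"
    using assms(3) unfolding istar_0[symmetric] by blast
  then obtain w where "\<psi>s = map istar w"
    by (metis ex_map_conv subsetD rangeE)
  then show ?thesis
    using compose_word_normal_form[of w] assms(2) by blast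
qed

end
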